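(* Let $X(t)$ be the coordinate Gibbs sampler for the diagonal distribution with parameter $A$. There exist constants $\alpha',\beta'>0$ such that for all large enough $A$, $$t_{\rm mix}(X,\alpha')>\beta' A^2 .$$
   Context: For $A>0$ let $\varphi(x)=\exp(-A^2x^2)$ and let $\pi$ be the probability distribution on $[0,1]^2$ with density proportional to $\varphi(u-v)$ at $(u,v)\in[0,1]^2$. For fixed $v\in[0,1]$, $\pi(\cdot,v)$ denotes the conditional distribution of the $u$ coordinate given $v$, i.e. the distribution on $[0,1]$ with density in $u$ proportional to $\varphi(u-v)$; similarly $\pi(u,\cdot)$ is the conditional distribution of the $v$ coordinate given $u$. The coordinate Gibbs sampler for the diagonal distribution is the Markov chain $X(t)=(X_u(t),X_v(t))$, $t=0,1,2,\dots$, on $[0,1]^2$ defined as follows. Let $r(1),r(2),\dots$ be i.i.d. with values in $\{U,V\}$, each taken with probability $1/2$. Given $X(0)\in[0,1]^2$, for $t\ge1$: if $r(t)=U$, then $X(t)=(u^+,X_v(t-1))$ with $u^+\sim\pi(\cdot,X_v(t-1))$; if $r(t)=V$, then $X(t)=(X_u(t-1),v^+)$ with $v^+\sim\pi(X_u(t-1),\cdot)$. The variables $u^+,v^+$ are conditionally independent of the past at every step. The distribution $\pi$ is stationary for this chain. Total variation distance: $\|\rho-\sigma\|_{\rm TV}=\sup_{S}|\rho(S)-\sigma(S)|$, the supremum being over measurable sets. With $\mathcal{L}(X(t))$ the law of $X(t)$, the mixing time is $$t_{\rm mix}(X,\varepsilon)=\sup_{X(0)\in[0,1]^2}\min\{t:\|\mathcal{L}(X(t))-\pi\|_{\rm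 TV}\le\varepsilon\},$$ the supremum being over deterministic starting points. *)

theory Defs
  imports "HOL-Probability.Probability"
begin

definition phi :: "real \<Rightarrow> real \<Rightarrow> real" where
  "phi A x = exp (- (A\<^sup>2 * x\<^sup>2))"

abbreviation unit_square :: "(real \<times> real) set" where
  "unit_square \<equiv> {0..1} \<times> {0..1}"

(* Distributions on [0,1] and on [0,1]^2 are Borel measures on the whole line and on the
   whole plane that give mass 1 to [0,1] and [0,1]^2. *)

definition diag_dist :: "real \<Rightarrow> (real \<times> real) measure" where
  "diag_dist A = density lborel (\<lambda>p.
     ennreal (indicator unit_square p * phi A (fst p - snd p) /
       (LINT q:unit_square|lborel. phi A (fst q - snd q))))"

definition cond_u :: "real \<Rightarrow> real \<Rightarrow> real measure" where
  "cond_u A v = density lborel (\<lambda>u.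
     ennreal (indicator {0..1} u * phi A (u - v) / (LINT u':{0..1}|lborel. phi A (u' - v))))"

definition cond_v :: "real \<Rightarrow> real \<Rightarrow> real measure" where
  "cond_v A u = density lborel (\<lambda>v.
     ennreal (indicator {0..1} v * phi A (u - v) / (LINT v':{0..1}|lborel. phi A (u - v'))))"

datatype coord = Coord_U | Coord_V

fun update_coord :: "real \<Rightarrow> coord \<Rightarrow> real \<times> real \<Rightarrow> (real \<times> real) measure" where
  "update_coord A Coord_U (u, v) = distr (cond_u A v) borel (\<lambda>u'. (u', v))"
| "update_coord A Coord_V (u, v) = distr (cond_v A u) borel (\<lambda>v'. (u, v'))"

definition gibbs_kernel :: "real \<Rightarrow> real \<times> real \<Rightarrow> (real \<times> real) measure" where
  "gibbs_kernel A x =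
     measure_pmf (pmf_of_set {Coord_U, Coord_V}) \<bind> (\<lambda>r. update_coord A r x)"

(* The law of X(t) for the chain started at the deterministic point x. *)
fun gibbs_law :: "real \<Rightarrow> real \<times> real \<Rightarrow> nat \<Rightarrow> (real \<times> real) measure" where
  "gibbs_law A x 0 = return borel x"
| "gibbs_law A x (Suc t) = gibbs_law A x t \<bind> gibbs_kernel A"

definition tv_dist :: "'a measure \<Rightarrow> 'a measure \<Rightarrow> real" where
  "tv_dist M N = (SUP S\<in>sets M. \<bar>measure M S - measure N S\<bar>)"

(* In enat the infimum of a nonempty set is its minimum, and the infimum of the empty set is
   infinity. *)
definition t_mix :: "real \<Rightarrow> real \<Rightarrow> enat" where
  "t_mix A \<epsilon> =
     (SUP x\<in>unit_square. INF t\<in>{t. tv_dist (gibbs_law A x t) (diag_dist A) \<le> \<epsilon>}. enat t)"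

(* The kernels are measurable and all laws are probability measures, so bind and distr above
   never take their default values. *)

lemma phi_measurable [measurable]: "phi A \<in> borel_measurable borel"
  unfolding phi_def by measurable

lemma phi_pos: "phi A x > 0" by (simp add: phi_def)

lemma continuous_on_phi [continuous_intros]: "continuous_on S f \<Longrightarrow> continuous_on S (\<lambda>x. phi A (f x))"
  unfolding phi_def by (intro continuous_intros)

lemma prob_space_normalized:
  fixes f :: "'a::euclidean_space \<Rightarrow> real"
  assumes S: "compact S" and pos: "\<And>x. f x > 0" and cont: "continuous_on S f"
    and [measurable]: "f \<in> borel_measurable borel" and ne: "emeasure lborel S \<noteq> 0"
  shows "prob_space (density lborel (\<lambda>x. ennreal (indicator S x * f x / (LINT y:S|lborel. f y))))"
proof -
  have [measurable]: "S \<in> sets borel" using S by (simp add: borel_compact)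
  let ?Z = "LINT y:S|lborel. f y"
  have int: "set_integrable lborel S f" 
    using S cont by (rule borel_integrable_compact[unfolded set_integrable_def[symmetric]])
  have int': "integrable lborel (\<lambda>x. indicator S x * f x)" 
    using int unfolding set_integrable_def by simp
  have Z: "?Z = (LINT x|lborel. indicator S x * f x)" by (simp add: set_lebesgue_integral_def)
  have "?Z > 0"
  proof -
    have "?Z \<ge> 0" unfolding Z using pos by (intro integral_nonneg_AE AE_I2) (simp add: less_imp_le)
    moreover have "?Z \<noteq> 0"
    proof
      assume "?Z = 0"
      then have "AE x in lborel. indicator S x * f x = 0"
        unfolding Z using integral_nonneg_eq_0_iff_AE[OF int'] pos by (simp add: less_imp_le)
      then have "AE x in lborel. x \<notin> S"
        by eventually_elim (use pos in \<open>auto simp: indicator_def less_le split: if_splits; metis less_irrefl\<close>)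
      then have "emeasure lborel S = 0"
        by (subst (asm) AE_iff_measurable[where N = S]) auto
      then show False using ne by simp
    qed
    ultimately show ?thesis by simp
  qed
  show ?thesis
  proof (rule prob_spaceI)
    have "integrable lborel (\<lambda>x. indicator S x * f x / ?Z)" using int' by simp
    then have "(\<integral>\<^sup>+x. ennreal (indicator S x * f x / ?Z) \<partial>lborel) = ennreal (LINT x|lborel. indicator S x * f x / ?Z)"
      using pos \<open>?Z > 0\<close> by (intro nn_integral_eq_integral AE_I2) (auto simp: less_imp_le)
    also have "\<dots> = 1" using \<open>?Z > 0\<close> Z by simp
    finally show "emeasure (density lborel (\<lambda>x. ennreal (indicator S x * f x / ?Z)))
      (space (density lborel (\<lambda>x. ennreal (indicator S x * f x / ?Z)))) = 1"
      by (simp add: emeasure_density)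
  qed
qed

lemma prob_space_diag_dist: "prob_space (diag_dist A)"
proof -
  have "emeasure lborel unit_square \<noteq> 0"
    by (simp add: lborel_prod[symmetric] lborel.emeasure_pair_measure_Times)
  then show ?thesis
    unfolding diag_dist_def
    by (intro prob_space_normalized)
      (auto intro!: compact_Times continuous_intros simp: phi_pos borel_prod[symmetric])
qed

lemma prob_space_cond: "prob_space (cond_u A v)" "prob_space (cond_v A u)"
  unfolding cond_u_def cond_v_def
  by (intro prob_space_normalized; auto intro!: continuous_intros simp: phi_pos)+

lemma sets_cond [measurable_cong, simp]: "sets (cond_u A v) = sets borel" "sets (cond_v A u) = sets borel"
  by (simp_all add: cond_u_def cond_v_def)

lemma cond_measurable [measurable]:
  "cond_u A \<in> borel \<rightarrow>\<^sub>M prob_algebra borel" "cond_v A \<in> borel \<rightarrow>\<^sub>M prob_algebra borel"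
proof -
  have *: "f \<in> borel \<rightarrow>\<^sub>M prob_algebra borel" 
    if "\<And>x. prob_space (f x)" "f = (\<lambda>x. density lborel (g x))" "case_prod g \<in> borel_measurable (borel \<Otimes>\<^sub>M borel)"
    for f :: "real \<Rightarrow> real measure" and g
  proof (rule measurable_prob_algebraI)
    have [measurable]: "case_prod g \<in> borel_measurable (borel \<Otimes>\<^sub>M lborel)"
      using that(3) by simp
    show "f \<in> borel \<rightarrow>\<^sub>M subprob_algebra borel"
    proof (rule measurable_subprob_algebra)
      fix B :: "real set" assume [measurable]: "B \<in> sets borel"
      have "(\<lambda>x. emeasure (f x) B) = (\<lambda>x. \<integral>\<^sup>+y. g x y * indicator B y \<partial>lborel)"
        unfolding that(2) by (subst emeasure_density) auto
      also have "\<dots> \<in> borel_measurable borel" by measurable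
      finally show "(\<lambda>x. emeasure (f x) B) \<in> borel_measurable borel" .
    qed (use that in \<open>auto intro: prob_space_imp_subprob_space\<close>)
  qed (rule that)
  have [measurable]: "(\<lambda>v. LINT u:{0..1}|lborel. phi A (u - v)) \<in> borel_measurable borel"
     "(\<lambda>v. LINT u:{0..1}|lborel. phi A (v - u)) \<in> borel_measurable borel"
    unfolding set_lebesgue_integral_def by measurable
  show "cond_u A \<in> borel \<rightarrow>\<^sub>M prob_algebra borel" "cond_v A \<in> borel \<rightarrow>\<^sub>M prob_algebra borel"
    by (rule *[OF prob_space_cond(1) ext[OF cond_u_def]], measurable)
       (rule *[OF prob_space_cond(2) ext[OF cond_v_def]], measurable)
qed

lemma update_coord_alt:
  "update_coord A Coord_U = (\<lambda>x. distr (cond_u A (snd x)) borel (\<lambda>u. (u, snd x)))"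
  "update_coord A Coord_V = (\<lambda>x. distr (cond_v A (fst x)) borel (\<lambda>v. (fst x, v)))"
  by (auto simp: fun_eq_iff)

lemma update_coord_measurable [measurable]:
  "update_coord A r \<in> borel \<rightarrow>\<^sub>M prob_algebra borel"
proof (cases r)
  case Coord_U
  have "(\<lambda>x. cond_u A (snd x)) \<in> borel \<Otimes>\<^sub>M borel \<rightarrow>\<^sub>M prob_algebra borel"
    "(\<lambda>(x, u). (u, snd x)) \<in> (borel \<Otimes>\<^sub>M borel) \<Otimes>\<^sub>M borel \<rightarrow>\<^sub>M borel \<Otimes>\<^sub>M borel"
    by measurable
  then show ?thesis unfolding Coord_U update_coord_alt borel_prod[symmetric]
    by (rule measurable_distr_prob_space2)
next
  case Coord_V
  have "(\<lambda>x. cond_v A (fst x)) \<in> borel \<Otimes>\<^sub>M borel \<rightarrow>\<^sub>M prob_algebra borel"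
    "(\<lambda>(x, v). (fst x, v)) \<in> (borel \<Otimes>\<^sub>M borel) \<Otimes>\<^sub>M borel \<rightarrow>\<^sub>M borel \<Otimes>\<^sub>M borel"
    by measurable
  then show ?thesis unfolding Coord_V update_coord_alt borel_prod[symmetric]
    by (rule measurable_distr_prob_space2)
qed

lemma gibbs_kernel_measurable [measurable]: "gibbs_kernel A \<in> borel \<rightarrow>\<^sub>M prob_algebra borel"
proof -
  have 1: "(\<lambda>x. measure_pmf (pmf_of_set {Coord_U, Coord_V})) \<in> (borel :: (real \<times> real) measure) \<rightarrow>\<^sub>M prob_algebra (count_space UNIV)"
    by (intro measurable_const) (simp add: space_prob_algebra measure_pmf.prob_space_axioms)
  have 2: "(\<lambda>(x, r). update_coord A r x) \<in> borel \<Otimes>\<^sub>M count_space UNIV \<rightarrow>\<^sub>M prob_algebra borel"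
  proof -
    have "countable (UNIV :: coord set)"
      using coord.exhaust by (intro countable_subset[of UNIV "{Coord_U, Coord_V}"]) auto
    then have "(\<lambda>p. (\<lambda>r q. update_coord A r (fst q)) (snd p) p) \<in> borel \<Otimes>\<^sub>M count_space UNIV \<rightarrow>\<^sub>M prob_algebra borel"
      by (rule measurable_compose_countable'[rotated -1]) simp_all
    then show ?thesis by (simp add: case_prod_beta')
  qed
  show ?thesis unfolding gibbs_kernel_def[abs_def]
    by (rule measurable_bind_prob_space2[OF 1 2])
qed

lemma gibbs_law_in_prob_algebra: "gibbs_law A x t \<in> space (prob_algebra borel)"
proof (induction t)
  case (Suc t)
  then have "(\<lambda>_::unit. gibbs_law A x t) \<in> count_space UNIV \<rightarrow>\<^sub>M prob_algebra borel" by simp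
  from measurable_bind_prob_space[OF this gibbs_kernel_measurable]
  have "(\<lambda>_::unit. gibbs_law A x (Suc t)) \<in> count_space UNIV \<rightarrow>\<^sub>M prob_algebra borel" by simp
  from measurable_space[OF this, of "()"] show ?case by simp
qed (simp add: space_prob_algebra prob_space_return)

lemma prob_space_gibbs_law: "prob_space (gibbs_law A x t)"
  and sets_gibbs_law: "sets (gibbs_law A x t) = sets borel"
  using gibbs_law_in_prob_algebra[of A x t] by (simp_all add: space_prob_algebra)

end

theory Submission imports Defs begin

text \<open>
  Let \<open>g x = 3 x\<^sup>2 - 2 x\<^sup>3\<close>, so that \<open>g' 0 = g' 1 = 0\<close>. When \<open>u\<close> is resampled given \<open>v\<close>, the
  expectation of \<open>g u\<close> differs from \<open>g v\<close> by at most \<open>6 / A\<^sup>2\<close>: away from the ends of \<open>[0,1]\<close> the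
  mean displacement is negligible, and near them \<open>g'\<close> is small. Hence the expectation of
  \<open>g u + g v\<close> changes by at most \<open>6 / A\<^sup>2\<close> per step. Started from \<open>(0,0)\<close>, the chain therefore
  satisfies \<open>g u + g v < 1\<close> with high probability for \<open>\<beta> A\<^sup>2\<close> steps, and started from \<open>(1,1)\<close> it
  satisfies \<open>g u + g v \<ge> 1\<close> with high probability for as long. The stationary distribution cannot
  give large mass to both of these complementary events.
\<close>

section \<open>Drift of the smooth step under resampling of one coordinate\<close>

definition smooth_step :: "real \<Rightarrow> real" where
  "smooth_step x = 3 * x\<^sup>2 - 2 * x ^ 3"

lemma smooth_step_bounds:
  assumes "x \<in> {0..1}"
  shows "0 \<le> smooth_step x" "smooth_step x \<le> 1"
proof -
  have "smooth_step x = x\<^sup>2 * (3 - 2 * x)" "1 - smooth_step x = (1 - x)\<^sup>2 * (1 + 2 * x)"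
    by (simp_all add: smooth_step_def power2_eq_square power3_eq_cube algebra_simps)
  moreover have "0 \<le> x\<^sup>2 * (3 - 2 * x)" "0 \<le> (1 - x)\<^sup>2 * (1 + 2 * x)"
    using assms by (auto intro!: mult_nonneg_nonneg)
  ultimately show "0 \<le> smooth_step x" "smooth_step x \<le> 1" by linarith+
qed

text \<open>With \<open>y = A * x\<close> this is \<open>y <= 1 + y^2 <= exp (y^2)\<close>. It
  controls boundary terms in an integration by parts.\<close>

lemma mult_phi_le:
  assumes "A > 0" "x \<ge> 0"
  shows "x * phi A x \<le> 1 / A"
proof -
  have "2 * (A * x) \<le> 1 + (A * x)\<^sup>2"
    using zero_le_power2[of "A * x - 1"] unfolding power2_diff by simp
  moreover have "0 \<le> A * x" using assms by simp
  ultimately have "A * x \<le> 1 + (A * x)\<^sup>2" by linarith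
  also have "\<dots> \<le> exp ((A * x)\<^sup>2)" by (rule exp_ge_add_one_self)
  finally have "A * x \<le> exp (A\<^sup>2 * x\<^sup>2)" by (simp add: power_mult_distrib)
  then show ?thesis using assms by (simp add: phi_def exp_minus field_simps)
qed

text \<open>A window of length \<open>1 / A\<close>, at most 1/2, with endpoint \<open>v\<close>
  fits into [0,1], and \<open>phi\<close> is at least \<open>exp (-1)\<close> on it; the factor 3 is
  an upper bound for e. Boundary terms of order \<open>1 / A\<close> can thus be absorbed into the
  normalizing integral.\<close>

lemma phi_integral_ge:
  assumes A: "A \<ge> 2" and v: "v \<in> {0..1}"
  shows "(LINT u:{0..1}|lborel. phi A (u - v)) \<ge> 1 / (3 * A)"
proof -
  define a where "a = (if v \<le> 1/2 then v else v - 1 / A)"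
  have "0 \<le> 1 / A" "1 / A \<le> 1 / 2" using A by (simp_all add: field_simps)
  then have "0 \<le> a \<and> a + 1 / A \<le> 1"
    using v by (cases "v \<le> 1 / 2"; simp only: a_def if_True if_False atLeastAtMost_iff; linarith)
  then have sub: "{a..a + 1/A} \<subseteq> {0..1}" by auto
  have near: "phi A (u - v) \<ge> exp (-1)" if "u \<in> {a..a + 1/A}" for u
  proof -
    have "\<bar>u - v\<bar> \<le> 1 / A" using that A by (auto simp: a_def split: if_splits)
    then have "\<bar>A * (u - v)\<bar> \<le> 1" using A by (simp add: abs_mult pos_le_divide_eq mult.commute)
    then have "A\<^sup>2 * (u - v)\<^sup>2 \<le> 1" by (simp add: abs_square_le_1 power_mult_distrib[symmetric])
    then show ?thesis by (simp add: phi_def)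
  qed
  have "1 / (3 * A) \<le> exp (-1) * (1 / A)"
    using exp_le A by (simp add: exp_minus field_simps)
  also have "\<dots> = (LINT u:{a..a + 1/A}|lborel. exp (-1))"
    using A by (simp add: set_lebesgue_integral_def)
  also have "\<dots> \<le> (LINT u:{0..1}|lborel. phi A (u - v))"
    unfolding set_lebesgue_integral_def
  proof (rule integral_mono)
    show "integrable lborel (\<lambda>u. indicator {0..1} u *\<^sub>R phi A (u - v))"
      by (rule borel_integrable_compact) (auto intro!: continuous_intros)
    show "integrable lborel (\<lambda>u. indicator {a..a + 1/A} u *\<^sub>R exp (-1::real))"
      by (rule borel_integrable_compact) auto
    show "indicator {a..a + 1/A} u *\<^sub>R exp (-1) \<le> indicator {0..1} u *\<^sub>R phi A (u - v)" for u
      using near[of u] subsetD[OF sub, of u]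
      by (cases "u \<in> {a..a + 1/A}") (simp_all add: phi_pos less_imp_le)
  qed
  finally show ?thesis .
qed

text \<open>Integration by parts leaves boundary terms at 0 and 1 and the integral of
  \<open>k' u * phi A (u - v)\<close>, all divided by \<open>2 * A\<^sup>2\<close>. Each of them is
  at most a constant times the normalizing integral.\<close>

lemma smooth_step_drift:
  assumes A: "A \<ge> 2" and v: "v \<in> {0..1}"
  shows "\<bar>LINT u:{0..1}|lborel. (smooth_step u - smooth_step v) * phi A (u - v)\<bar>
    \<le> 6 / A\<^sup>2 * (LINT u:{0..1}|lborel. phi A (u - v))" (is "\<bar>?I\<bar> \<le> _ * ?Z")
proof -
  \<comment> \<open>\<open>k u\<close> is the difference quotient of \<open>smooth_step\<close> between \<open>u\<close> and \<open>v\<close>, so the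
    integrand is \<open>k u\<close> times \<open>(u - v) * phi A (u - v)\<close>, and the latter has the antiderivative
    \<open>- phi A (u - v) / (2 * A\<^sup>2)\<close>.\<close>
  define k where "k u = 3 * (u + v) - 2 * (u\<^sup>2 + u * v + v\<^sup>2)" for u
  define k' where "k' u = 3 - 4 * u - 2 * v" for u
  define F where "F u = - (k u * phi A (u - v)) / (2 * A\<^sup>2)" for u
  define R where "R = (LINT u:{0..1}|lborel. k' u * phi A (u - v))"
  note int = borel_integrable_atLeastAtMost'
  have Z: "?Z \<ge> 1 / (3 * A)" by (rule phi_integral_ge[OF A v])
  have "(LINT u:{0..1}|lborel. (smooth_step u - smooth_step v) * phi A (u - v)
      - k' u * phi A (u - v) / (2 * A\<^sup>2)) = F 1 - F 0"
    unfolding set_lebesgue_integral_def real_scaleR_def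
  proof (subst mult.commute, rule integral_FTC_Icc_real)
    fix u :: real
    have k: "k u * (u - v) = smooth_step u - smooth_step v"
      by (simp add: k_def smooth_step_def power2_eq_square power3_eq_cube algebra_simps)
    have eq: "(smooth_step u - smooth_step v) * phi A (u - v) - k' u * phi A (u - v) / (2 * A\<^sup>2)
      = - (k u * (- (A\<^sup>2 * (2 * (u - v))) * phi A (u - v)) + k' u * phi A (u - v)) / (2 * A\<^sup>2)"
      using A by (simp add: field_simps flip: k)
    have "DERIV k u :> k' u"
      unfolding k_def[abs_def] k'_def by (auto intro!: derivative_eq_intros)
    moreover have "DERIV (\<lambda>u. phi A (u - v)) u :> - (A\<^sup>2 * (2 * (u - v))) * phi A (u - v)"
      unfolding phi_def by (auto intro!: derivative_eq_intros)
    ultimately show "DERIV F u :> (smooth_step u - smooth_step v) * phi A (u - v)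
      - k' u * phi A (u - v) / (2 * A\<^sup>2)"
      unfolding eq F_def[abs_def] by (intro DERIV_cdivide DERIV_minus DERIV_mult')
    show "isCont (\<lambda>u. (smooth_step u - smooth_step v) * phi A (u - v)
      - k' u * phi A (u - v) / (2 * A\<^sup>2)) u"
      unfolding k'_def smooth_step_def phi_def using A by (intro continuous_intros) auto
  qed simp
  moreover have "(LINT u:{0..1}|lborel. (smooth_step u - smooth_step v) * phi A (u - v)
      - k' u * phi A (u - v) / (2 * A\<^sup>2)) = ?I - R / (2 * A\<^sup>2)"
    unfolding R_def k'_def smooth_step_def
    by (subst set_integral_diff) (use A in \<open>auto intro!: int continuous_intros\<close>)
  ultimately have I: "?I = F 1 - F 0 + R / (2 * A\<^sup>2)" by simp
  have cont_k': "continuous_on {0..1} (\<lambda>u. k' u * phi A (u - v))"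
    unfolding k'_def by (intro continuous_intros)
  have "\<bar>R\<bar> \<le> (LINT u:{0..1}|lborel. \<bar>k' u * phi A (u - v)\<bar>)"
    using set_integral_norm_bound[OF int[OF cont_k']] by (simp add: R_def)
  also have "\<dots> \<le> (LINT u:{0..1}|lborel. 3 * phi A (u - v))"
  proof (rule set_integral_mono)
    fix u :: real assume "u \<in> {0..1}"
    then have "\<bar>k' u\<bar> \<le> 3" using v by (auto simp: k'_def)
    then show "\<bar>k' u * phi A (u - v)\<bar> \<le> 3 * phi A (u - v)"
      by (simp add: abs_mult phi_pos less_imp_le)
  qed (intro int continuous_intros cont_k')+
  finally have R: "\<bar>R\<bar> \<le> 3 * ?Z" by simp
  have phi_sym: "phi A (0 - v) = phi A v" by (simp add: phi_def)
  \<comment> \<open>Here the flatness of \<open>smooth_step\<close> at 0 and 1 enters: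
    \<open>k 0\<close> vanishes linearly as \<open>v\<close> tends to 0 and \<open>k 1\<close> as
    \<open>v\<close> tends to 1, which is where \<open>phi\<close> in the respective boundary term
    is not small.\<close>
  have "k 0 = v * (3 - 2 * v)" "k 1 = (1 - v) * (1 + 2 * v)"
    by (simp_all add: k_def power2_eq_square algebra_simps)
  then have k: "0 \<le> k 0" "k 0 \<le> 3 * v" "0 \<le> k 1" "k 1 \<le> 3 * (1 - v)"
    using v mult_left_mono[of "3 - 2 * v" 3 v] mult_left_mono[of "1 + 2 * v" 3 "1 - v"]
    by (simp_all add: mult.commute[of 3])
  have "k 0 * phi A v \<le> 3 * (v * phi A v)" "k 1 * phi A (1 - v) \<le> 3 * ((1 - v) * phi A (1 - v))"
    using k by (simp_all add: phi_pos less_imp_le flip: mult.assoc)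
  moreover have "v * phi A v \<le> 1 / A" "(1 - v) * phi A (1 - v) \<le> 1 / A"
    using A v by (auto intro!: mult_phi_le)
  ultimately have "k 0 * phi A v \<le> 3 / A" "k 1 * phi A (1 - v) \<le> 3 / A" by simp_all
  moreover have "0 \<le> k 0 * phi A v" "0 \<le> k 1 * phi A (1 - v)"
    using k by (simp_all add: phi_pos less_imp_le)
  moreover have "3 / A \<le> 9 * ?Z" using Z A by (simp add: field_simps)
  \<comment> \<open>Both boundary terms lie between 0 and \<open>9 * ?Z\<close>, so their difference
    is at most \<open>9 * ?Z\<close> in absolute value; \<open>R\<close> adds \<open>3 * ?Z\<close>.
    Division by \<open>2 * A\<^sup>2\<close> turns 12 into the final 6.\<close>
  ultimately have "\<bar>k 0 * phi A v - k 1 * phi A (1 - v) + R\<bar> \<le> 12 * ?Z" using R by linarith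
  moreover have "?I = (k 0 * phi A v - k 1 * phi A (1 - v) + R) / (2 * A\<^sup>2)"
    unfolding I F_def phi_sym by (simp add: add_divide_distrib diff_divide_distrib)
  ultimately show ?thesis using A by (simp add: abs_mult field_simps)
qed

section \<open>Drift of the chain\<close>

text \<open>The value \<open>\<infinity>\<close> outside \<open>[0,1]\<close> spares a separate proof that the chain stays in the
  unit square.\<close>

definition extend_top :: "(real \<Rightarrow> real) \<Rightarrow> real \<Rightarrow> ennreal" where
  "extend_top h u = (if u \<in> {0..1} then ennreal (h u) else \<infinity>)"

lemma extend_top_measurable [measurable]:
  assumes [measurable]: "h \<in> borel_measurable borel"
  shows "extend_top h \<in> borel_measurable borel"
  unfolding extend_top_def[abs_def] by measurable

text \<open>Division by the normalizing integral turns the drift hypothesis into a bound on the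
  conditional expectation; for \<open>v\<close> outside [0,1] the right side is infinite. A general
  \<open>h\<close> covers both \<open>smooth_step\<close> and
  \<open>1 - smooth_step\<close>.\<close>

lemma nn_integral_cond_u_extend_top:
  assumes A: "A \<ge> 2" and cont: "continuous_on UNIV h" and nonneg: "\<And>u. u \<in> {0..1} \<Longrightarrow> h u \<ge> 0"
    and drift: "\<And>v. v \<in> {0..1} \<Longrightarrow> (LINT u:{0..1}|lborel. (h u - h v) * phi A (u - v))
      \<le> c * (LINT u:{0..1}|lborel. phi A (u - v))" and c: "c \<ge> 0"
  shows "(\<integral>\<^sup>+u. extend_top h u \<partial>cond_u A v) \<le> extend_top h v + ennreal c"
proof (cases "v \<in> {0..1}")
  case v: True
  let ?Z = "LINT u:{0..1}|lborel. phi A (u - v)"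
  have [measurable]: "h \<in> borel_measurable borel"
    using cont by (rule borel_measurable_continuous_onI)
  have Z: "?Z > 0"
    by (rule less_le_trans[OF _ phi_integral_ge[OF A v]]) (use A in simp)
  have cont': "continuous_on {0..1} h" using cont by (rule continuous_on_subset) simp
  note int = borel_integrable_atLeastAtMost'
  have ih: "integrable lborel (\<lambda>u. indicator {0..1} u *\<^sub>R (h u * phi A (u - v)))"
    by (rule int[unfolded set_integrable_def]) (use cont' in \<open>auto intro!: continuous_intros\<close>)
  have "(\<integral>\<^sup>+u. extend_top h u \<partial>cond_u A v)
      = (\<integral>\<^sup>+u. ennreal (indicator {0..1} u *\<^sub>R (h u * phi A (u - v)) / ?Z) \<partial>lborel)"
    unfolding cond_u_def using Z nonneg
    by (subst nn_integral_density)
      (auto simp: extend_top_def indicator_def ennreal_mult'[symmetric] phi_pos less_imp_le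
         divide_nonneg_pos mult.commute intro!: nn_integral_cong)
  also have "\<dots> = ennreal ((LINT u:{0..1}|lborel. h u * phi A (u - v)) / ?Z)"
    unfolding set_lebesgue_integral_def using Z nonneg ih
    by (subst nn_integral_eq_integral)
      (auto simp: indicator_def set_lebesgue_integral_def phi_pos less_imp_le)
  also have "(LINT u:{0..1}|lborel. (h u - h v) * phi A (u - v))
      = (LINT u:{0..1}|lborel. h u * phi A (u - v)) - h v * ?Z"
    unfolding left_diff_distrib using cont'
    by (subst set_integral_diff) (auto intro!: int continuous_intros)
  then have "(LINT u:{0..1}|lborel. h u * phi A (u - v)) / ?Z \<le> h v + c"
    using drift[OF v] Z by (simp add: field_simps)
  then have "ennreal ((LINT u:{0..1}|lborel. h u * phi A (u - v)) / ?Z) \<le> ennreal (h v + c)"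
    by (rule ennreal_leI)
  finally show ?thesis using v c nonneg[OF v] by (simp add: extend_top_def)
qed (auto simp: extend_top_def)

text \<open>Since \<open>phi\<close> is even, one drift bound serves both coordinates.\<close>

lemma cond_v_eq_cond_u: "cond_v A = cond_u A"
  by (simp add: fun_eq_iff cond_v_def cond_u_def phi_def power2_commute)

lemma nn_integral_gibbs_kernel:
  assumes [measurable]: "f \<in> borel_measurable borel"
  shows "(\<integral>\<^sup>+y. f y \<partial>gibbs_kernel A x) =
    ((\<integral>\<^sup>+u. f (u, snd x) \<partial>cond_u A (snd x)) + (\<integral>\<^sup>+v. f (fst x, v) \<partial>cond_u A (fst x))) / 2"
proof -
  have [measurable]: "(\<lambda>u::real. (u, b)) \<in> borel \<rightarrow>\<^sub>M borel" "(\<lambda>u::real. (b, u)) \<in> borel \<rightarrow>\<^sub>M borel"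
    for b :: real
    unfolding borel_prod[symmetric] by measurable
  have "update_coord A r x \<in> space (prob_algebra borel)" for r
    by (rule measurable_space[OF update_coord_measurable]) simp
  then have "update_coord A r x \<in> space (subprob_algebra borel)" for r
    by (simp add: space_prob_algebra space_subprob_algebra prob_space_imp_subprob_space)
  then have "(\<integral>\<^sup>+y. f y \<partial>gibbs_kernel A x) =
      (\<integral>\<^sup>+r. \<integral>\<^sup>+y. f y \<partial>update_coord A r x \<partial>measure_pmf (pmf_of_set {Coord_U, Coord_V}))"
    unfolding gibbs_kernel_def by (intro nn_integral_bind[where B = borel]) auto
  also have "\<dots> = ((\<integral>\<^sup>+y. f y \<partial>update_coord A Coord_U x) + (\<integral>\<^sup>+y. f y \<partial>update_coord A Coord_V x)) / 2"
    by (subst nn_integral_pmf_of_set) (auto simp: sum_divide_distrib)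
  also have "(\<integral>\<^sup>+y. f y \<partial>update_coord A Coord_U x) = (\<integral>\<^sup>+u. f (u, snd x) \<partial>cond_u A (snd x))"
    unfolding update_coord_alt by (subst nn_integral_distr) auto
  also have "(\<integral>\<^sup>+y. f y \<partial>update_coord A Coord_V x) = (\<integral>\<^sup>+v. f (fst x, v) \<partial>cond_u A (fst x))"
    unfolding update_coord_alt cond_v_eq_cond_u
    by (subst nn_integral_distr) auto
  finally show ?thesis .
qed

text \<open>Resampling the first coordinate replaces the sum by at most
  \<open>2 * w (snd x) + c\<close> in expectation, resampling the second by at most
  \<open>2 * w (fst x) + c\<close>. Either move alone can change the sum considerably, but the fair
  average of the two bounds is the old sum plus \<open>c\<close>.\<close>

lemma nn_integral_gibbs_kernel_sum_le:
  fixes w :: "real \<Rightarrow> ennreal"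
  assumes [measurable]: "w \<in> borel_measurable borel"
    and drift: "\<And>v. (\<integral>\<^sup>+u. w u \<partial>cond_u A v) \<le> w v + c"
  shows "(\<integral>\<^sup>+y. w (fst y) + w (snd y) \<partial>gibbs_kernel A x) \<le> w (fst x) + w (snd x) + c"
proof -
  have sum: "(\<integral>\<^sup>+u. w u + a \<partial>cond_u A v) \<le> (w v + c) + a" for a v
  proof -
    interpret prob_space "cond_u A v" by (rule prob_space_cond)
    have "(\<integral>\<^sup>+u. w u + a \<partial>cond_u A v) = (\<integral>\<^sup>+u. w u \<partial>cond_u A v) + a"
      by (subst nn_integral_add) (auto simp: emeasure_space_1)
    then show ?thesis using drift[of v] by (simp add: add_right_mono)
  qed
  have meas: "(\<lambda>y. w (fst y) + w (snd y)) \<in> borel_measurable borel"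
    unfolding borel_prod[symmetric] by measurable
  have "(\<integral>\<^sup>+y. w (fst y) + w (snd y) \<partial>gibbs_kernel A x)
      = ((\<integral>\<^sup>+u. w u + w (snd x) \<partial>cond_u A (snd x))
        + (\<integral>\<^sup>+v. w v + w (fst x) \<partial>cond_u A (fst x))) / 2"
    by (simp add: nn_integral_gibbs_kernel[OF meas] add.commute)
  also have "\<dots> \<le> (((w (snd x) + c) + w (snd x)) + ((w (fst x) + c) + w (fst x))) / 2"
    by (intro divide_right_mono_ennreal add_mono sum)
  also have "\<dots> = ((w (fst x) + w (snd x) + c) * 2) / 2"
    by (simp add: mult_2_right add_ac)
  also have "\<dots> = w (fst x) + w (snd x) + c"
    by (rule mult_divide_eq_ennreal) simp_all
  finally show ?thesis .
qed

lemma nn_integral_gibbs_law_sum_le: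
  fixes w :: "real \<Rightarrow> ennreal"
  assumes [measurable]: "w \<in> borel_measurable borel"
    and drift: "\<And>v. (\<integral>\<^sup>+u. w u \<partial>cond_u A v) \<le> w v + c"
  shows "(\<integral>\<^sup>+y. w (fst y) + w (snd y) \<partial>gibbs_law A x t) \<le> w (fst x) + w (snd x) + of_nat t * c"
proof (induction t)
  case 0
  have [measurable]: "(\<lambda>y. w (fst y) + w (snd y)) \<in> borel_measurable borel"
    unfolding borel_prod[symmetric] by measurable
  show ?case by (simp add: nn_integral_return)
next
  case (Suc t)
  have [measurable]: "(\<lambda>y. w (fst y) + w (snd y)) \<in> borel_measurable borel"
    unfolding borel_prod[symmetric] by measurable
  interpret prob_space "gibbs_law A x t" by (rule prob_space_gibbs_law)
  note [measurable_cong] = sets_gibbs_law[of A x t]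
  have "(\<integral>\<^sup>+y. w (fst y) + w (snd y) \<partial>gibbs_law A x (Suc t))
      = (\<integral>\<^sup>+z. \<integral>\<^sup>+y. w (fst y) + w (snd y) \<partial>gibbs_kernel A z \<partial>gibbs_law A x t)"
    by (simp, rule nn_integral_bind[where B = borel])
      (auto intro: measurable_prob_algebraD simp: measurable_cong_sets[OF sets_gibbs_law refl])
  also have "\<dots> \<le> (\<integral>\<^sup>+z. w (fst z) + w (snd z) + c \<partial>gibbs_law A x t)"
    by (intro nn_integral_mono nn_integral_gibbs_kernel_sum_le drift) simp
  also have "\<dots> = (\<integral>\<^sup>+z. w (fst z) + w (snd z) \<partial>gibbs_law A x t) + c"
    by (subst nn_integral_add) (auto simp: emeasure_space_1)
  also have "\<dots> \<le> w (fst x) + w (snd x) + of_nat t * c + c"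
    using Suc by (rule add_right_mono)
  finally show ?case by (simp add: algebra_simps)
qed

section \<open>Total variation, mixing time and the lower bound\<close>

lemma abs_measure_diff_le_tv_dist:
  assumes "prob_space M" "prob_space N" "S \<in> sets M"
  shows "\<bar>measure M S - measure N S\<bar> \<le> tv_dist M N"
  unfolding tv_dist_def
\<comment> \<open>A real supremum is an upper bound only for a bounded family, so boundedness by 1
  has to be shown.\<close>
proof (rule cSUP_upper[OF assms(3)], rule bdd_aboveI2)
  fix S
  have "0 \<le> measure M S" "measure M S \<le> 1" "0 \<le> measure N S" "measure N S \<le> 1"
    using assms by (auto intro: prob_space.prob_le_1)
  then show "\<bar>measure M S - measure N S\<bar> \<le> 1" by linarith
qed

text \<open>A finite value excludes the infimum over the empty set, and a nonempty set in
  \<open>enat\<close> attains its infimum.\<close>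

lemma t_mix_attained:
  assumes "t_mix A \<epsilon> < \<infinity>" "x \<in> unit_square"
  obtains t where "tv_dist (gibbs_law A x t) (diag_dist A) \<le> \<epsilon>" "enat t \<le> t_mix A \<epsilon>"
proof -
  let ?T = "{t. tv_dist (gibbs_law A x t) (diag_dist A) \<le> \<epsilon>}"
  have le: "(INF t\<in>?T. enat t) \<le> t_mix A \<epsilon>"
    unfolding t_mix_def by (rule SUP_upper[OF assms(2)])
  have "enat ` ?T \<noteq> {}"
  proof
    assume "enat ` ?T = {}"
    then have "(INF t\<in>?T. enat t) = \<infinity>" by (simp only: Inf_empty top_enat_def)
    then show False using le assms(1) by simp
  qed
  then have "(INF t\<in>?T. enat t) \<in> enat ` ?T" by (metis ex_in_conv wellorder_InfI)
  then show ?thesis using le that by auto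
qed

text \<open>Start the chain at \<open>(x, x)\<close>, where the sum of the \<open>h\<close> values
  is 0. At some time up to \<open>\<beta> * A\<^sup>2\<close> its law is within \<alpha> of
  stationarity, while the drift \<open>6 / A\<^sup>2\<close> per step and Markov's inequality give
  \<open>S\<close> mass at most \<open>6 * \<beta>\<close> under that law.\<close>

lemma diag_dist_measure_le:
  assumes A: "A \<ge> 2" and cont: "continuous_on UNIV h" and nonneg: "\<And>u. u \<in> {0..1} \<Longrightarrow> h u \<ge> 0"
    and drift: "\<And>v. v \<in> {0..1} \<Longrightarrow> (LINT u:{0..1}|lborel. (h u - h v) * phi A (u - v))
      \<le> 6 / A\<^sup>2 * (LINT u:{0..1}|lborel. phi A (u - v))"
    and x: "x \<in> {0..1}" "h x = 0"
    and t_mix: "ereal_of_enat (t_mix A \<alpha>) \<le> ereal (\<beta> * A\<^sup>2)"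
    and [measurable]: "S \<in> sets borel" and S: "\<And>p. p \<in> S \<Longrightarrow> 1 \<le> h (fst p) + h (snd p)"
  shows "measure (diag_dist A) S \<le> \<alpha> + 6 * \<beta>"
proof -
  have "t_mix A \<alpha> < \<infinity>" using t_mix by (cases "t_mix A \<alpha>") auto
  moreover have "(x, x) \<in> unit_square" using x by simp
  ultimately obtain t where tv: "tv_dist (gibbs_law A (x, x) t) (diag_dist A) \<le> \<alpha>"
    and t: "enat t \<le> t_mix A \<alpha>" by (rule t_mix_attained)
  from t t_mix have t': "real t \<le> \<beta> * A\<^sup>2" by (cases "t_mix A \<alpha>") auto
  let ?L = "gibbs_law A (x, x) t"
  interpret L: prob_space ?L by (rule prob_space_gibbs_law)
  note [measurable_cong] = sets_gibbs_law[of A "(x, x)" t]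
  let ?w = "extend_top h"
  have [measurable]: "h \<in> borel_measurable borel"
    using cont by (rule borel_measurable_continuous_onI)
  \<comment> \<open>Markov's inequality pointwise: off the unit square the right side is infinite,
    inside it the assumption on \<open>S\<close> applies.\<close>
  have "indicator S p \<le> ?w (fst p) + ?w (snd p)" for p
    using S[of p] nonneg by (auto simp: extend_top_def indicator_def simp flip: ennreal_plus ennreal_1
        intro!: ennreal_leI)
  then have "(\<integral>\<^sup>+p. indicator S p \<partial>?L) \<le> (\<integral>\<^sup>+p. ?w (fst p) + ?w (snd p) \<partial>?L)"
    by (rule nn_integral_mono)
  then have "emeasure ?L S \<le> (\<integral>\<^sup>+p. ?w (fst p) + ?w (snd p) \<partial>?L)"
    by (simp add: sets_gibbs_law)
  also have "\<dots> \<le> ?w (fst (x, x)) + ?w (snd (x, x)) + of_nat t * ennreal (6 / A\<^sup>2)"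
    by (intro nn_integral_gibbs_law_sum_le nn_integral_cond_u_extend_top A cont nonneg drift) auto
  also have "\<dots> = ennreal (real t * (6 / A\<^sup>2))"
    using x by (simp add: extend_top_def ennreal_of_nat_eq_real_of_nat flip: ennreal_mult)
  finally have "measure ?L S \<le> real t * (6 / A\<^sup>2)"
    by (simp add: L.emeasure_eq_measure)
  also have "\<dots> \<le> 6 * \<beta>" using t' A by (simp add: field_simps)
  finally have "measure ?L S \<le> 6 * \<beta>" .
  moreover have "\<bar>measure ?L S - measure (diag_dist A) S\<bar> \<le> \<alpha>"
    by (rule order_trans[OF abs_measure_diff_le_tv_dist tv])
      (auto simp: prob_space_gibbs_law prob_space_diag_dist sets_gibbs_law)
  ultimately show ?thesis by linarith
qed

theorem theorem16:
  "\<exists>\<alpha>>0. \<exists>\<beta>>0. \<forall>\<^sub>F A in at_top. ereal (\<beta> * A\<^sup>2) < ereal_of_enat (t_mix A \<alpha>)"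
proof (intro exI conjI)
  \<comment> \<open>With these values \<open>?\<alpha> + 6 * ?\<beta>\<close> is 1/4, so
    \<open>S\<close> and its complement would together have mass at most 1/2 instead of 1.\<close>
  let ?\<alpha> = "1 / 8 :: real" and ?\<beta> = "1 / 48 :: real"
  show "\<forall>\<^sub>F A in at_top. ereal (?\<beta> * A\<^sup>2) < ereal_of_enat (t_mix A ?\<alpha>)"
    using eventually_ge_at_top[of 2]
  proof eventually_elim
    case (elim A)
    show ?case
    proof (rule ccontr)
      assume "\<not> ?thesis"
      then have t_mix: "ereal_of_enat (t_mix A ?\<alpha>) \<le> ereal (?\<beta> * A\<^sup>2)" by simp
      let ?g = smooth_step
      define S where "S = {p :: real \<times> real. 1 \<le> ?g (fst p) + ?g (snd p)}"
      have [measurable]: "?g \<in> borel_measurable borel"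
        unfolding smooth_step_def[abs_def] by measurable
      have S [measurable]: "S \<in> sets borel"
      proof -
        have "{p \<in> space (borel \<Otimes>\<^sub>M borel). 1 \<le> ?g (fst p) + ?g (snd p)} \<in> sets (borel \<Otimes>\<^sub>M borel)"
          by measurable
        then show ?thesis unfolding S_def borel_prod by simp
      qed
      interpret pi: prob_space "diag_dist A" by (rule prob_space_diag_dist)
      have cont: "continuous_on UNIV ?g"
        unfolding smooth_step_def by (intro continuous_intros)
      have le: "measure (diag_dist A) S \<le> ?\<alpha> + 6 * ?\<beta>"
        using smooth_step_drift[OF elim]
        by (intro diag_dist_measure_le[where h = ?g and x = 0] elim t_mix S cont)
          (auto simp: smooth_step_bounds S_def abs_le_iff, simp add: smooth_step_def)
      \<comment> \<open>The drift of \<open>1 - ?g\<close> is the negative of that of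
        \<open>?g\<close>, so the two-sided bound of \<open>smooth_step_drift\<close> also serves
        the chain started at (1,1).\<close>
      have "(LINT u:{0..1}|lborel. ((1 - ?g u) - (1 - ?g v)) * phi A (u - v))
          = - (LINT u:{0..1}|lborel. (?g u - ?g v) * phi A (u - v))" for v
        unfolding set_lebesgue_integral_def integral_minus[symmetric]
        by (intro Bochner_Integration.integral_cong) (auto simp: algebra_simps)
      then have "measure (diag_dist A) (- S) \<le> ?\<alpha> + 6 * ?\<beta>"
        using smooth_step_drift[OF elim]
        by (intro diag_dist_measure_le[where h = "\<lambda>u. 1 - ?g u" and x = 1] elim t_mix
            continuous_intros cont borel_comp S)
          (auto simp: smooth_step_bounds S_def abs_le_iff, simp add: smooth_step_def)
      moreover have "measure (diag_dist A) (- S) = 1 - measure (diag_dist A) S"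
        using pi.prob_compl[of S] by (simp add: diag_dist_def Compl_eq_Diff_UNIV)
      ultimately show False using le by simp
    qed
  qed
qed auto

end
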